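(* $\mathsf{S}_1(\mathcal{B}_\mathrm{T},\mathcal{B}_\Gamma)=\mathsf{T}\cap\mathsf{B}$.
   Context: All spaces $X$ are infinite sets of reals; all covers considered are assumed not to contain $X$ as a member. A cover is a $\gamma$-cover of $X$ if it is infinite and each point lies in all but finitely many members; large if each point lies in infinitely many members. A large cover $\mathcal{U}$ is a $\tau$-cover if for all $x,y\in X$, either ($x\in U\Rightarrow y\in U$) for all but finitely many $U\in\mathcal{U}$, or ($y\in U\Rightarrow x\in U$) for all but finitely many $U\in\mathcal{U}$. $\mathcal{B}_\Gamma,\mathcal{B}_\mathrm{T}$ are the collections of countable Borel $\gamma$-, $\tau$-covers of $X$. $X$ satisfies $\mathsf{S}_1(\mathcal{B}_\mathrm{T},\mathcal{B}_\Gamma)$ if for every sequence $(\mathcal{U}_n)$ of members of $\mathcal{B}_\mathrm{T}$ there are $U_n\in\mathcal{U}_n$ with $\{U_n:n\in\mathbb{N}\}\in\mathcal{B}_\Gamma$. $[\mathbb{N}]^\infty$ is the space of infinite subsets of $\mathbb{N}$; $a\subseteq^*b$ means $a\setminus b$ finite; a tower is a family in $[\mathbb{N}]^\infty$ linearly quasiordered by $\subseteq^*$ with no infinite $a$ satisfying $a\subseteq^* b$ for all its members $b$. A Borel image of $X$ in $Z$ is $f[X]$ for Borel $f:X\to Z$. $\mathsf{T}$: the class of $X$ such that no Borel image of $X$ in $[\mathbb{N}]^\infty$ is a tower. $\mathsf{B}$: the class of $X$ such that every Borel image of $X$ in $\mathbb{N}^\mathbb{N}$ is bounded with respect to eventual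 domination $\le^*$ ($f\le^*g$ iff $f(n)\le g(n)$ for all but finitely many $n$). *)

theory Defs
  imports "HOL-Analysis.Analysis"
begin

section \<open>Covers\<close>

text \<open>
  A space is an infinite set of reals \<open>X\<close> with the subspace topology; its Borel sigma-algebra is
  \<open>restrict_space borel X\<close>.  All covers consist of subsets of \<open>X\<close> and do not contain \<open>X\<close> itself.
\<close>

definition is_cover :: "'a set \<Rightarrow> 'a set set \<Rightarrow> bool" where
  "is_cover X \<U> \<longleftrightarrow> \<U> \<subseteq> Pow X \<and> \<Union>\<U> = X \<and> X \<notin> \<U>"

definition large_cover :: "'a set \<Rightarrow> 'a set set \<Rightarrow> bool" where
  "large_cover X \<U> \<longleftrightarrow> is_cover X \<U> \<and> (\<forall>x\<in>X. infinite {U \<in> \<U>. x \<in> U})"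

definition gamma_cover :: "'a set \<Rightarrow> 'a set set \<Rightarrow> bool" where
  "gamma_cover X \<U> \<longleftrightarrow> is_cover X \<U> \<and> infinite \<U> \<and> (\<forall>x\<in>X. finite {U \<in> \<U>. x \<notin> U})"

definition tau_cover :: "'a set \<Rightarrow> 'a set set \<Rightarrow> bool" where
  "tau_cover X \<U> \<longleftrightarrow> large_cover X \<U> \<and>
     (\<forall>x\<in>X. \<forall>y\<in>X. finite {U \<in> \<U>. \<not> (x \<in> U \<longrightarrow> y \<in> U)} \<or>
                    finite {U \<in> \<U>. \<not> (y \<in> U \<longrightarrow> x \<in> U)})"

definition B_Gamma :: "real set \<Rightarrow> real set set set" where
  "B_Gamma X = {\<U>. countable \<U> \<and> \<U> \<subseteq> sets (restrict_space borel X) \<and> gamma_cover X \<U>}"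

definition B_Tau :: "real set \<Rightarrow> real set set set" where
  "B_Tau X = {\<U>. countable \<U> \<and> \<U> \<subseteq> sets (restrict_space borel X) \<and> tau_cover X \<U>}"

text \<open>
  The selection hypothesis, as the class of all spaces satisfying it.  Note that the \<^emph>\<open>set\<close> of
  selected members has to be in the target collection, so for \<open>B_Gamma\<close> it has to be infinite.
\<close>

definition S1 :: "(real set \<Rightarrow> real set set set) \<Rightarrow> (real set \<Rightarrow> real set set set) \<Rightarrow> real set set" where
  "S1 \<A> \<B> = {X. infinite X \<and>
     (\<forall>\<U> :: nat \<Rightarrow> real set set. (\<forall>n. \<U> n \<in> \<A> X) \<longrightarrow>
        (\<exists>U :: nat \<Rightarrow> real set. (\<forall>n. U n \<in> \<U> n) \<and> range U \<in> \<B> X))}"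


section \<open>Borel images\<close>

definition borel_images :: "real set \<Rightarrow> 'b measure \<Rightarrow> 'b set set" where
  "borel_images X M = {f ` X | f. f \<in> measurable (restrict_space borel X) M}"

text \<open>
  The Borel structure of the space of infinite subsets of the naturals.  A set is identified with its
  characteristic function; \<open>nat \<Rightarrow> bool\<close> carries the product of the discrete topologies.
\<close>

definition infinite_sets_borel :: "nat set measure" where
  "infinite_sets_borel =
     restrict_space (vimage_algebra UNIV (\<lambda>a n. n \<in> a) (borel :: (nat \<Rightarrow> bool) measure)) {a. infinite a}"

definition almost_subset :: "nat set \<Rightarrow> nat set \<Rightarrow> bool" (infix "\<subseteq>\<^sup>*" 50) where
  "a \<subseteq>\<^sup>* b \<longleftrightarrow> finite (a - b)"

definition tower :: "nat set set \<Rightarrow> bool" where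
  "tower T \<longleftrightarrow> (\<forall>a\<in>T. infinite a) \<and> (\<forall>a\<in>T. \<forall>b\<in>T. a \<subseteq>\<^sup>* b \<or> b \<subseteq>\<^sup>* a) \<and>
     \<not> (\<exists>a. infinite a \<and> (\<forall>b\<in>T. a \<subseteq>\<^sup>* b))"

definition eventually_le :: "(nat \<Rightarrow> nat) \<Rightarrow> (nat \<Rightarrow> nat) \<Rightarrow> bool" (infix "\<le>\<^sup>*" 50) where
  "f \<le>\<^sup>* g \<longleftrightarrow> finite {n. \<not> f n \<le> g n}"

definition eventually_bounded :: "(nat \<Rightarrow> nat) set \<Rightarrow> bool" where
  "eventually_bounded F \<longleftrightarrow> (\<exists>g. \<forall>f\<in>F. f \<le>\<^sup>* g)"

definition class_T :: "real set set" where
  "class_T = {X. infinite X \<and> (\<forall>Y \<in> borel_images X infinite_sets_borel. \<not> tower Y)}"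

text \<open>In \<open>class_B\<close>, \<open>nat \<Rightarrow> nat\<close> carries the product of the discrete topologies (Baire space).\<close>

definition class_B :: "real set set" where
  "class_B = {X. infinite X \<and>
     (\<forall>Y \<in> borel_images X (borel :: (nat \<Rightarrow> nat) measure). eventually_bounded Y)}"

end

theory Submission
  imports Defs
begin

text \<open>
  An injectively enumerated cover \<open>(V\<^sub>n)\<close> is coded by the map sending \<open>x\<close> to \<open>{n. x \<in> V\<^sub>n}\<close>: it is a
  \<open>\<tau>\<close>-cover iff the image consists of infinite sets and is linearly quasiordered by \<open>\<subseteq>\<^sup>*\<close>, and an infinite
  set \<open>a\<close> is a pseudo-intersection of the image iff \<open>(V\<^sub>n)\<^sub>n\<^sub>\<in>\<^sub>a\<close> is a \<open>\<gamma>\<close>-cover.  Hence no Borel image of \<open>X\<close>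
  is a tower iff every countable Borel \<open>\<tau>\<close>-cover of \<open>X\<close> contains a \<open>\<gamma>\<close>-cover.  Given \<open>\<gamma>\<close>-covers
  \<open>(V\<^sub>n\<^sub>,\<^sub>m)\<^sub>m\<close>, a bound for the functions \<open>n \<mapsto> min {k. \<forall>m\<ge>k. x \<in> V\<^sub>n\<^sub>,\<^sub>m}\<close> performs the selection;
  conversely a selection from the covers \<open>{x. f x n \<le> m}\<close>, \<open>m \<in> \<nat>\<close>, yields a bound for the image of \<open>f\<close>.
  As the covers have to consist of infinitely many proper subsets, the Borel maps are first modified
  on a countable set.
\<close>

section \<open>Measurability tested by coordinates\<close>

instance bool :: second_countable_topology
proof
  show "\<exists>B::bool set set. countable B \<and> open = generate_topology B"
    by (intro exI[of _ "range lessThan \<union> range greaterThan"]) (auto simp: open_bool_def)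
qed

lemma measurable_infinite_sets_borel_iff:
  "f \<in> measurable M infinite_sets_borel \<longleftrightarrow>
     (\<forall>x\<in>space M. infinite (f x)) \<and> (\<forall>n. {x\<in>space M. n \<in> f x} \<in> sets M)"
proof -
  let ?V = "vimage_algebra UNIV (\<lambda>a n. n \<in> a) (borel :: (nat \<Rightarrow> bool) measure)"
  have "f \<in> measurable M ?V \<longleftrightarrow> (\<lambda>x n. n \<in> f x) \<in> borel_measurable M"
  proof
    assume "f \<in> measurable M ?V"
    from measurable_compose[OF this measurable_vimage_algebra1]
    show "(\<lambda>x n. n \<in> f x) \<in> borel_measurable M" by auto
  qed (auto intro: measurable_vimage_algebra2)
  \<comment> \<open>Coordinatewise testing rests on \<open>bool\<close> being second countable: then
    the Borel sets of \<open>nat => bool\<close> are generated by the coordinates.\<close>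
  also have "\<dots> \<longleftrightarrow> (\<forall>n. (\<lambda>x. n \<in> f x) \<in> borel_measurable M)"
    using measurable_product_then_coordinatewise[of "\<lambda>x n. n \<in> f x" M]
      measurable_coordinatewise_then_product[of "\<lambda>x n. n \<in> f x" M]
    by blast
  also have "\<dots> \<longleftrightarrow> (\<forall>n. {x\<in>space M. n \<in> f x} \<in> sets M)"
    by (simp add: measurable_cong_sets[OF refl sets_borel_eq_count_space] pred_def)
  finally show ?thesis
    unfolding infinite_sets_borel_def measurable_restrict_space2_iff by auto
qed

lemma borel_measurable_nat_fun_iff:
  fixes f :: "'a \<Rightarrow> nat \<Rightarrow> nat"
  shows "f \<in> borel_measurable M \<longleftrightarrow> (\<forall>n. (\<lambda>x. f x n) \<in> measurable M (count_space UNIV))"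
proof -
  have "f \<in> borel_measurable M \<longleftrightarrow> (\<forall>n. (\<lambda>x. f x n) \<in> borel_measurable M)"
    using measurable_product_then_coordinatewise[of f M]
      measurable_coordinatewise_then_product[of f M]
    by blast
  then show ?thesis
    by (simp add: measurable_cong_sets[OF refl sets_borel_eq_count_space])
qed

section \<open>Covers listed without repetition\<close>

lemma finite_Collect_range_iff:
  assumes "inj V"
  shows "finite {U \<in> range V. P U} \<longleftrightarrow> finite {n. P (V n)}"
proof -
  have "{U \<in> range V. P U} = V ` {n. P (V n)}" by auto
  then show ?thesis using assms by (simp add: finite_image_iff inj_on_subset)
qed

lemma gamma_cover_range_iff:
  fixes V :: "nat \<Rightarrow> 'a set"
  assumes "inj V"
  shows "gamma_cover X (range V) \<longleftrightarrow> (\<forall>n. V n \<subset> X) \<and> (\<forall>x\<in>X. finite {n. x \<notin> V n})"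
proof -
  note fin = finite_Collect_range_iff[OF assms]
  have "X \<subseteq> \<Union>(range V)" if "\<forall>x\<in>X. finite {n. x \<notin> V n}"
  proof
    fix x assume "x \<in> X"
    with that have "{n. x \<notin> V n} \<noteq> UNIV" using infinite_UNIV_nat by metis
    then show "x \<in> \<Union>(range V)" by auto
  qed
  moreover have "infinite (range V)"
    using assms finite_imageD by blast
  ultimately show ?thesis
    unfolding gamma_cover_def is_cover_def fin by blast
qed

lemma tau_cover_range_iff:
  fixes V :: "nat \<Rightarrow> 'a set"
  assumes "inj V"
  shows "tau_cover X (range V) \<longleftrightarrow>
    (\<forall>n. V n \<subset> X) \<and> (\<forall>x\<in>X. infinite {n. x \<in> V n}) \<and>
    (\<forall>x\<in>X. \<forall>y\<in>X. {n. x \<in> V n} \<subseteq>\<^sup>* {n. y \<in> V n} \<or> {n. y \<in> V n} \<subseteq>\<^sup>* {n. x \<in> V n})"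
proof -
  note fin = finite_Collect_range_iff[OF assms]
  have cover: "is_cover X (range V) \<longleftrightarrow> (\<forall>n. V n \<subset> X) \<and> X \<subseteq> \<Union>(range V)"
    unfolding is_cover_def by blast
  have "(\<forall>x\<in>X. infinite {n. x \<in> V n}) \<longrightarrow> X \<subseteq> \<Union>(range V)"
  proof (intro impI subsetI)
    fix x assume "\<forall>x\<in>X. infinite {n. x \<in> V n}" "x \<in> X"
    then have "{n. x \<in> V n} \<noteq> {}" by (metis finite.emptyI)
    then show "x \<in> \<Union>(range V)" by auto
  qed
  moreover have diff: "{n. x \<in> V n} - {n. y \<in> V n} = {n. \<not> (x \<in> V n \<longrightarrow> y \<in> V n)}" for x y
    by auto
  ultimately show ?thesis
    unfolding tau_cover_def large_cover_def cover fin almost_subset_def diff by argo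
qed

lemma gamma_cover_imp_tau_cover:
  assumes "gamma_cover X \<U>"
  shows "tau_cover X \<U>"
proof -
  have inf: "infinite \<U>" and fin: "\<And>x. x \<in> X \<Longrightarrow> finite {U \<in> \<U>. x \<notin> U}"
    using assms by (auto simp: gamma_cover_def)
  have "infinite {U \<in> \<U>. x \<in> U}" if "x \<in> X" for x
  proof
    assume "finite {U \<in> \<U>. x \<in> U}"
    then have "finite ({U \<in> \<U>. x \<in> U} \<union> {U \<in> \<U>. x \<notin> U})" using fin[OF that] by simp
    moreover have "\<U> \<subseteq> {U \<in> \<U>. x \<in> U} \<union> {U \<in> \<U>. x \<notin> U}" by auto
    ultimately show False using inf finite_subset by blast
  qed
  \<comment> \<open>Only members missing \<open>y\<close> can violate the implication, and these are
    finitely many whatever \<open>x\<close> is.\<close>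
  moreover have "finite {U \<in> \<U>. \<not> (x \<in> U \<longrightarrow> y \<in> U)}" if "y \<in> X" for x y
    by (rule finite_subset[OF _ fin[OF that]]) auto
  ultimately show ?thesis
    using assms by (auto simp: tau_cover_def large_cover_def gamma_cover_def)
qed

lemma B_Gamma_subset_B_Tau: "B_Gamma X \<subseteq> B_Tau X"
  using gamma_cover_imp_tau_cover by (auto simp: B_Gamma_def B_Tau_def)

lemma S1_D:
  assumes "X \<in> S1 \<A> \<B>" "\<And>n::nat. \<U> n \<in> \<A> X"
  shows "\<exists>U. (\<forall>n. U n \<in> \<U> n) \<and> range U \<in> \<B> X"
  using assms by (simp add: S1_def)

lemma countable_in_sets_restrict_borel:
  fixes A X :: "'a::t1_space set"
  assumes "countable A" "A \<subseteq> X"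
  shows "A \<in> sets (restrict_space borel X)"
  using sets.countable[of A borel] assms by (auto simp: sets_restrict_space)

text \<open>Largeness at a single point already forces a cover to be infinite; hence the point taken
  from \<open>X\<close>.\<close>

lemma B_Tau_enumeration:
  assumes "\<U> \<in> B_Tau X" "X \<noteq> {}"
  obtains V :: "nat \<Rightarrow> real set" where "inj V" "\<U> = range V"
proof -
  obtain x where "x \<in> X" using assms by auto
  then have "infinite {U \<in> \<U>. x \<in> U}" using assms
    by (auto simp: B_Tau_def tau_cover_def large_cover_def)
  then have "infinite \<U>" by (metis (no_types, lifting) finite_subset mem_Collect_eq subsetI)
  moreover from assms have "countable \<U>" by (simp add: B_Tau_def)
  ultimately have "bij_betw (from_nat_into \<U>) UNIV \<U>"
    by (simp add: bij_betw_from_nat_into)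
  then show thesis using that by (metis bij_betw_def)
qed

section \<open>From \<open>class_T\<close> and \<open>class_B\<close> to the selection
  property\<close>

lemma B_Tau_contains_B_Gamma:
  assumes "X \<in> class_T" "\<U> \<in> B_Tau X"
  obtains V :: "nat \<Rightarrow> real set" where "inj V" "range V \<subseteq> \<U>" "range V \<in> B_Gamma X"
proof -
  have "X \<noteq> {}" using assms by (auto simp: class_T_def)
  then obtain W :: "nat \<Rightarrow> real set" where W: "inj W" "\<U> = range W"
    using B_Tau_enumeration assms by metis
  have tau: "tau_cover X (range W)" and meas: "\<And>n. W n \<in> sets (restrict_space borel X)"
    using assms W by (auto simp: B_Tau_def)
  note tau' = tau[unfolded tau_cover_range_iff[OF W(1)]]
  define h where "h x = {n. x \<in> W n}" for x
  have "{x \<in> space (restrict_space borel X). n \<in> h x} = W n" for n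
    using tau' by (auto simp: h_def space_restrict_space)
  then have "h \<in> measurable (restrict_space borel X) infinite_sets_borel"
    using tau' meas by (auto simp: measurable_infinite_sets_borel_iff h_def space_restrict_space)
  then have "h ` X \<in> borel_images X infinite_sets_borel"
    by (auto simp: borel_images_def)
  then have "\<not> tower (h ` X)" using assms by (auto simp: class_T_def)
  moreover have "\<forall>a\<in>h ` X. infinite a"
    "\<forall>a\<in>h ` X. \<forall>b\<in>h ` X. a \<subseteq>\<^sup>* b \<or> b \<subseteq>\<^sup>* a"
    using tau' by (auto simp: h_def)
  ultimately have "\<exists>a. infinite a \<and> (\<forall>b\<in>h ` X. a \<subseteq>\<^sup>* b)"
    unfolding tower_def by argo
  then obtain a where a: "infinite a" "\<And>x. x \<in> X \<Longrightarrow> a \<subseteq>\<^sup>* h x"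
    by auto
  \<comment> \<open>Members are kept only at indices in the pseudo-intersection \<open>a\<close>; a
    point \<open>x\<close> is missed only at indices in \<open>a - h x\<close>, a finite
    set.\<close>
  define V where "V = W \<circ> enumerate a"
  have inj: "inj V"
    unfolding V_def using W(1) inj_enumerate[OF a(1)] by (rule inj_compose)
  have "finite {n. x \<notin> V n}" if "x \<in> X" for x
  proof -
    have "enumerate a ` {n. x \<notin> V n} \<subseteq> a - h x"
      using enumerate_in_set[OF a(1)] by (auto simp: V_def h_def)
    then have "finite (enumerate a ` {n. x \<notin> V n})"
      using a(2)[OF that] finite_subset by (auto simp: almost_subset_def)
    then show ?thesis
      using inj_enumerate[OF a(1)] by (simp add: finite_image_iff inj_on_subset)
  qed
  then have "gamma_cover X (range V)"
    unfolding gamma_cover_range_iff[OF inj] using tau' by (auto simp: V_def)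
  then have "range V \<in> B_Gamma X" using meas by (auto simp: B_Gamma_def V_def)
  moreover have "range V \<subseteq> \<U>" by (auto simp: V_def W)
  ultimately show thesis by (intro that[OF inj])
qed

text \<open>Any index above the bound serves as well as the bound itself. This freedom is spent on
  making the selected members distinct, so that their set is infinite.\<close>

lemma class_B_selection:
  fixes V :: "nat \<Rightarrow> nat \<Rightarrow> real set"
  assumes "X \<in> class_B" and inj: "\<And>n. inj (V n)" and V: "\<And>n. range (V n) \<in> B_Gamma X"
  obtains g where "range (\<lambda>n. V n (g n)) \<in> B_Gamma X"
proof -
  have "gamma_cover X (range (V n))" for n
    using V[of n] by (simp add: B_Gamma_def)
  then have gam: "\<And>n m. V n m \<subset> X" "\<And>x n. x \<in> X \<Longrightarrow> finite {m. x \<notin> V n m}"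
    unfolding gamma_cover_range_iff[OF inj] by blast+
  have meas: "V n m \<in> sets (restrict_space borel X)" for n m
    using V[of n] by (auto simp: B_Gamma_def)
  define f where "f x n = (LEAST k. \<forall>m\<ge>k. x \<in> V n m)" for x n
  have f: "x \<in> V n m" if "x \<in> X" "f x n \<le> m" for x n m
  proof -
    have "finite {m. x \<notin> V n m}" using gam(2) that by blast
    then obtain k where "\<forall>m\<in>{m. x \<notin> V n m}. m < k"
      unfolding finite_nat_set_iff_bounded by blast
    then have "\<forall>m\<ge>k. x \<in> V n m" by (auto simp: not_less)
    then have "\<forall>m\<ge>f x n. x \<in> V n m" unfolding f_def by (rule LeastI)
    with that show ?thesis by blast
  qed
  \<comment> \<open>The condition under \<open>LEAST\<close> is a countable intersection of such
    predicates, so \<open>f\<close> is measurable in each coordinate.\<close>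
  have "Measurable.pred (restrict_space borel X) (\<lambda>x. x \<in> V n m)" for n m
    by (rule pred_sets2[OF meas]) simp
  then have "(\<lambda>x. f x n) \<in> measurable (restrict_space borel X) (count_space UNIV)" for n
    unfolding f_def by measurable
  then have "f \<in> borel_measurable (restrict_space borel X)"
    by (simp add: borel_measurable_nat_fun_iff)
  then have "f ` X \<in> borel_images X borel" by (auto simp: borel_images_def)
  then have "eventually_bounded (f ` X)" using assms(1) by (simp add: class_B_def)
  then obtain b where b: "\<And>x. x \<in> X \<Longrightarrow> f x \<le>\<^sup>* b"
    by (auto simp: eventually_bounded_def)
  \<comment> \<open>By injectivity of \<open>V n\<close>, a finite \<open>S\<close> rules out only
    finitely many indices.\<close>
  have avoid: "\<exists>m. b n \<le> m \<and> V n m \<notin> S" if "finite S" for n and S :: "real set set"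
  proof -
    have "finite (V n -` S)" using that inj by (rule finite_vimageI)
    then have "\<not> {b n..} \<subseteq> V n -` S" using infinite_Ici finite_subset by blast
    then show ?thesis by auto
  qed
  define c where "c n S = (SOME m. b n \<le> m \<and> V n m \<notin> S)" for n S
  have c: "b n \<le> c n S \<and> V n (c n S) \<notin> S" if "finite S" for n S
    unfolding c_def using avoid[OF that] by (rule someI_ex)
  txt \<open>\<open>R n\<close> is the set of the first \<open>n\<close> selected members; avoiding it keeps the selection injective.\<close>
  define R where "R = rec_nat {} (\<lambda>n S. insert (V n (c n S)) S)"
  define g where "g n = c n (R n)" for n
  have R_Suc: "R (Suc n) = insert (V n (g n)) (R n)" for n by (simp add: R_def g_def)
  have "finite (R n)" for n by (induction n) (simp_all add: R_Suc, simp add: R_def)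
  then have g: "b n \<le> g n" "V n (g n) \<notin> R n" for n using c by (auto simp: g_def)
  have R: "V i (g i) \<in> R n" if "i < n" for i n
    using that by (induction n) (auto simp: R_Suc less_Suc_eq)
  have inj': "inj (\<lambda>n. V n (g n))"
    by (rule linorder_injI) (metis R g(2))
  have "finite {n. x \<notin> V n (g n)}" if "x \<in> X" for x
  proof (rule finite_subset)
    show "{n. x \<notin> V n (g n)} \<subseteq> {n. \<not> f x n \<le> b n}"
      using f[OF that] g(1) le_trans by blast
    show "finite {n. \<not> f x n \<le> b n}" using b[OF that] by (simp add: eventually_le_def)
  qed
  then have "gamma_cover X (range (\<lambda>n. V n (g n)))"
    unfolding gamma_cover_range_iff[OF inj'] using gam by blast
  then have "range (\<lambda>n. V n (g n)) \<in> B_Gamma X" using meas by (auto simp: B_Gamma_def)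
  then show thesis by (rule that)
qed

lemma class_T_class_B_subset_S1: "class_T \<inter> class_B \<subseteq> S1 B_Tau B_Gamma"
proof
  fix X assume X: "X \<in> class_T \<inter> class_B"
  have "\<exists>U. (\<forall>n. U n \<in> \<U> n) \<and> range U \<in> B_Gamma X"
    if "\<forall>n. \<U> n \<in> B_Tau X" for \<U> :: "nat \<Rightarrow> real set set"
  proof -
    have "\<exists>V :: nat \<Rightarrow> real set. inj V \<and> range V \<subseteq> \<U> n \<and> range V \<in> B_Gamma X" for n
      using B_Tau_contains_B_Gamma that X by (metis Int_iff)
    then obtain V :: "nat \<Rightarrow> nat \<Rightarrow> real set"
      where V: "\<And>n. inj (V n)" "\<And>n. range (V n) \<subseteq> \<U> n" "\<And>n. range (V n) \<in> B_Gamma X"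
      by metis
    obtain g where "range (\<lambda>n. V n (g n)) \<in> B_Gamma X"
      using class_B_selection[of X V, OF _ V(1,3)] X by auto
    then show ?thesis using V(2) by (intro exI[of _ "\<lambda>n. V n (g n)"]) auto
  qed
  then show "X \<in> S1 B_Tau B_Gamma" using X by (auto simp: S1_def class_T_def)
qed

section \<open>From the selection property to \<open>class_T\<close> and
  \<open>class_B\<close>\<close>

lemma S1_subset_class_T: "S1 B_Tau B_Gamma \<subseteq> class_T"
proof
  fix X assume X: "X \<in> S1 B_Tau B_Gamma"
  then have inf: "infinite X" by (simp add: S1_def)
  then obtain p :: "nat \<Rightarrow> real" where p: "inj p" "range p \<subseteq> X"
    using infinite_countable_subset by blast
  have "\<not> tower (f ` X)" if f: "f \<in> measurable (restrict_space borel X) infinite_sets_borel" for f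
  proof
    assume tower: "tower (f ` X)"
    have f_sets: "{x \<in> X. n \<in> f x} \<in> sets (restrict_space borel X)" for n
      using f by (simp add: measurable_infinite_sets_borel_iff space_restrict_space)
    txt \<open>The sets \<open>{x \<in> X. n \<in> f x}\<close> may repeat or equal \<open>X\<close>.  Prescribing the traces on \<open>range p\<close> of
      the final segments prevents both and changes each \<open>f x\<close> at finitely many places only.\<close>
    define V where "V n = ({x \<in> X. n \<in> f x} - {p n}) \<union> p ` {n<..}" for n
    have notin: "p n \<notin> V n" for n using p(1) by (auto simp: V_def inj_eq)
    have mem: "p n \<in> V m" if "m < n" for m n using that by (auto simp: V_def)
    have sub: "V n \<subset> X" for n using p(2) notin[of n] by (auto simp: V_def)
    \<comment> \<open>For \<open>m < n\<close> the point \<open>p n\<close> lies in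
      \<open>V m\<close> but not in \<open>V n\<close>.\<close>
    have injV: "inj V" by (rule linorder_injI) (metis notin mem)
    have meas: "V n \<in> sets (restrict_space borel X)" for n
      unfolding V_def using p(2)
      by (intro sets.Un sets.Diff f_sets countable_in_sets_restrict_borel) auto
    have diff: "finite (sym_diff {n. x \<in> V n} (f x))" if "x \<in> X" for x
    proof (cases "x \<in> range p")
      case True
      then obtain j where "x = p j" by auto
      \<comment> \<open>The point \<open>p j\<close> is put into \<open>V n\<close> for
        \<open>n < j\<close> and taken out for \<open>n = j\<close>; later indices agree with
        \<open>f x\<close>.\<close>
      then have "sym_diff {n. x \<in> V n} (f x) \<subseteq> {..j}"
        using that p(1) by (auto simp: V_def inj_eq)
      then show ?thesis using finite_subset by blast
    next
      case False
      then have "{n. x \<in> V n} = f x" using that by (auto simp: V_def)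
      then show ?thesis by simp
    qed
    have "infinite {n. x \<in> V n}" if "x \<in> X" for x
    proof
      assume "finite {n. x \<in> V n}"
      then have "finite ({n. x \<in> V n} \<union> sym_diff {n. x \<in> V n} (f x))"
        using diff[OF that] by simp
      then have "finite (f x)" by (rule finite_subset[rotated]) auto
      then show False using tower that by (auto simp: tower_def)
    qed
    moreover have "{n. x \<in> V n} \<subseteq>\<^sup>* {n. y \<in> V n} \<or> {n. y \<in> V n} \<subseteq>\<^sup>* {n. x \<in> V n}"
      if "x \<in> X" "y \<in> X" for x y
    proof -
      have *: "{n. x \<in> V n} \<subseteq>\<^sup>* {n. y \<in> V n}" if "f x \<subseteq>\<^sup>* f y" "x \<in> X" "y \<in> X" for x y
        unfolding almost_subset_def
      proof (rule finite_subset)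
        show "finite ((f x - f y) \<union> sym_diff {n. x \<in> V n} (f x) \<union> sym_diff {n. y \<in> V n} (f y))"
          using that diff by (auto simp: almost_subset_def)
      qed auto
      have "f x \<subseteq>\<^sup>* f y \<or> f y \<subseteq>\<^sup>* f x" using tower that by (auto simp: tower_def)
      then show ?thesis using * that by blast
    qed
    ultimately have "tau_cover X (range V)"
      unfolding tau_cover_range_iff[OF injV] using sub by blast
    then have V_tau: "range V \<in> B_Tau X" using meas by (auto simp: B_Tau_def)
    have "\<exists>U. (\<forall>n::nat. U n \<in> range V) \<and> range U \<in> B_Gamma X"
      using X V_tau by (rule S1_D)
    then obtain U where U: "\<forall>n::nat. U n \<in> range V" "range U \<in> B_Gamma X"
      by iprover
    \<comment> \<open>The indices of the selected members form a pseudo-intersection of the image of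
      \<open>f\<close>, contradicting \<open>tower\<close>.\<close>
    define a where "a = V -` range U"
    have "range U \<subseteq> range V" using U(1) by (intro image_subsetI) simp
    then have "V ` a = range U" unfolding a_def image_vimage_eq by (rule Int_absorb2)
    then have "infinite a" using U(2)
      by (metis (no_types, lifting) B_Gamma_def finite_imageI gamma_cover_def mem_Collect_eq)
    moreover have "a \<subseteq>\<^sup>* f x" if "x \<in> X" for x
      unfolding almost_subset_def
    proof (rule finite_subset)
      have "V ` {n \<in> a. x \<notin> V n} \<subseteq> {W \<in> range U. x \<notin> W}" by (auto simp: a_def)
      moreover have "finite {W \<in> range U. x \<notin> W}"
        using U(2) that by (simp add: B_Gamma_def gamma_cover_def)
      ultimately have "finite (V ` {n \<in> a. x \<notin> V n})" using finite_subset by blast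
      then have "finite {n \<in> a. x \<notin> V n}"
        using injV by (simp add: finite_image_iff inj_on_subset)
      then show "finite ({n \<in> a. x \<notin> V n} \<union> sym_diff {n. x \<in> V n} (f x))"
        using diff[OF that] by simp
    qed auto
    ultimately show False using tower by (auto simp: tower_def)
  qed
  then show "X \<in> class_T" using inf by (auto simp: class_T_def borel_images_def)
qed

lemma S1_subset_class_B: "S1 B_Tau B_Gamma \<subseteq> class_B"
proof
  fix X assume X: "X \<in> S1 B_Tau B_Gamma"
  then have inf: "infinite X" by (simp add: S1_def)
  then obtain p :: "nat \<Rightarrow> real" where p: "inj p" "range p \<subseteq> X"
    using infinite_countable_subset by blast
  have "eventually_bounded (f ` X)" if f: "f \<in> borel_measurable (restrict_space borel X)"
    for f :: "real \<Rightarrow> nat \<Rightarrow> nat"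
  proof -
    let ?M = "restrict_space borel X :: real measure"
    have f_meas: "(\<lambda>x. f x n) \<in> measurable ?M (count_space UNIV)" for n
      using f by (simp add: borel_measurable_nat_fun_iff)
    txt \<open>The summand \<open>j\<close> makes \<open>\<lambda>x. F x n\<close> unbounded on \<open>X\<close> for every \<open>n\<close>.\<close>
    define j where "j x = (if x \<in> range p then the_inv p x else 0)" for x
    have j_p: "j (p n) = n" for n using p(1) by (simp add: j_def the_inv_f_f)
    \<comment> \<open>\<open>j\<close> differs from the constant 0 only on a countable set.\<close>
    have j_meas: "j \<in> measurable ?M (count_space UNIV)"
    proof (rule measurable_discrete_difference[where f = "\<lambda>_. 0" and X = "range p"])
      show "{x} \<in> sets ?M" if "x \<in> range p" for x
        using that p(2) by (intro countable_in_sets_restrict_borel) auto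
    qed (auto simp: j_def)
    define F where "F x n = j x + (\<Sum>k\<le>n. f x k)" for x n
    have F_meas: "(\<lambda>x. F x n) \<in> measurable ?M (count_space UNIV)" for n
      unfolding F_def using f_meas j_meas by measurable
    \<comment> \<open>This is the purpose of the partial sums: a bound on \<open>F x\<close> at a
      later index also bounds \<open>f x n\<close>.\<close>
    have F_mono: "F x m \<le> F x n" if "m \<le> n" for x m n
      unfolding F_def using that by (intro add_left_mono sum_mono2) auto
    have f_le: "f x n \<le> F x n" for x n
      unfolding F_def by (rule trans_le_add2, rule member_le_sum) auto
    define V where "V n m = {x \<in> X. F x n \<le> m}" for n m
    have meas: "V n m \<in> sets ?M" for n m
    proof -
      have "V n m = (\<lambda>x. F x n) -` {..m} \<inter> space ?M" by (auto simp: V_def space_restrict_space)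
      then show ?thesis using measurable_sets[OF F_meas, of "{..m}"] by simp
    qed
    \<comment> \<open>The summand \<open>j\<close> alone gives \<open>p (Suc m)\<close> a value of
      at least \<open>Suc m\<close>, so no member is all of \<open>X\<close>.\<close>
    have notin: "p (Suc m) \<notin> V n m" for n m by (simp add: V_def F_def j_p)
    have V_ne: "V n m \<noteq> X" for n m using notin[of m n] p(2) by auto
    have Union_V: "\<Union>(range (V n)) = X" for n by (auto simp: V_def)
    have X_notin: "X \<notin> range (V n)" for n using V_ne by blast
    have "gamma_cover X (range (V n))" for n
      unfolding gamma_cover_def is_cover_def
    proof (intro conjI ballI)
      show "range (V n) \<subseteq> Pow X" by (auto simp: V_def)
      show "finite {U \<in> range (V n). x \<notin> U}" if "x \<in> X" for x
      proof (rule finite_subset)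
        show "{U \<in> range (V n). x \<notin> U} \<subseteq> V n ` {..<F x n}"
          using that by (auto simp: V_def)
      qed simp
      \<comment> \<open>Sets \<open>V n m\<close> may coincide for different \<open>m\<close>. But
        they form a chain, so if there were finitely many, their union \<open>X\<close> would be one
        of them.\<close>
      show "infinite (range (V n))"
      proof
        assume "finite (range (V n))"
        then have "\<Union>(range (V n)) \<in> range (V n)"
          by (rule Union_in_chain) (auto simp: subset.chain_def V_def)
        then show False using X_notin by (simp add: Union_V)
      qed
    qed (fact Union_V X_notin)+
    then have "range (V n) \<in> B_Gamma X" for n
      using meas by (auto simp: B_Gamma_def)
    then have V_tau: "range (V n) \<in> B_Tau X" for n
      using B_Gamma_subset_B_Tau by (rule rev_subsetD)
    have "\<exists>U. (\<forall>n. U n \<in> range (V n)) \<and> range U \<in> B_Gamma X"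
      using X V_tau by (rule S1_D)
    then obtain U where U: "\<forall>n. U n \<in> range (V n)" "range U \<in> B_Gamma X"
      by iprover
    have "\<exists>m. U n = V n m" for n using U(1) by (simp add: image_iff)
    then obtain g where g: "\<And>n. U n = V n (g n)" by metis
    txt \<open>As \<open>range U\<close> is \<open>\<gamma>\<close> only as a set of members, pass to indices with distinct members.\<close>
    define A where "A = {n. \<forall>i<n. U i \<noteq> U n}"
    have "range U \<subseteq> U ` A"
    proof clarify
      fix n
      let ?l = "LEAST i. U i = U n"
      have "U ?l = U n" by (rule LeastI) simp
      moreover from this have "?l \<in> A" unfolding A_def using not_less_Least by fastforce
      ultimately show "U n \<in> U ` A" by (metis imageI)
    qed
    moreover have "infinite (range U)" using U(2) by (simp add: B_Gamma_def gamma_cover_def)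
    ultimately have infA: "infinite A" using finite_subset finite_imageI by blast
    have injA: "inj_on U A" by (rule linorder_inj_onI) (auto simp: A_def)
    \<comment> \<open>The selection controls \<open>F x\<close> only along \<open>A\<close>; each
      \<open>n\<close> borrows the value of \<open>g\<close> at the first index of \<open>A\<close>
      from \<open>n\<close> on.\<close>
    define nxt where "nxt n = (LEAST k. n \<le> k \<and> k \<in> A)" for n
    have nxt_props: "n \<le> nxt n" "nxt n \<in> A" for n
    proof -
      obtain k where "n \<le> k \<and> k \<in> A" using infA by (metis infinite_nat_iff_unbounded_le)
      then have "n \<le> nxt n \<and> nxt n \<in> A" unfolding nxt_def by (rule LeastI)
      then show "n \<le> nxt n" "nxt n \<in> A" by auto
    qed
    have "f x \<le>\<^sup>* (\<lambda>n. g (nxt n))" if "x \<in> X" for x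
    proof -
      have "U ` {k \<in> A. x \<notin> U k} \<subseteq> {W \<in> range U. x \<notin> W}" by auto
      moreover have "finite {W \<in> range U. x \<notin> W}"
        using U(2) that by (simp add: B_Gamma_def gamma_cover_def)
      ultimately have "finite (U ` {k \<in> A. x \<notin> U k})" using finite_subset by blast
      moreover have "inj_on U {k \<in> A. x \<notin> U k}" using injA by (rule inj_on_subset) auto
      ultimately have fin: "finite {k \<in> A. x \<notin> U k}" by (simp add: finite_image_iff)
      \<comment> \<open>A failure at \<open>n\<close> makes \<open>nxt n\<close> one of the finitely
        many \<open>k\<close> in \<open>A\<close> with \<open>x\<close> outside \<open>U k\<close>,
        and each such \<open>k\<close> accounts only for \<open>n\<close> up to
        \<open>k\<close>.\<close>
      have "{n. \<not> f x n \<le> g (nxt n)} \<subseteq> (\<Union>k\<in>{k \<in> A. x \<notin> U k}. {..k})"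
      proof
        fix n assume "n \<in> {n. \<not> f x n \<le> g (nxt n)}"
        then have "\<not> F x (nxt n) \<le> g (nxt n)"
          using f_le[of x n] F_mono[OF nxt_props(1), of x n] by simp
        then have "x \<notin> U (nxt n)" by (simp add: g V_def)
        then show "n \<in> (\<Union>k\<in>{k \<in> A. x \<notin> U k}. {..k})" using nxt_props by blast
      qed
      then show ?thesis unfolding eventually_le_def using fin finite_subset by blast
    qed
    then show ?thesis by (auto simp: eventually_bounded_def)
  qed
  then show "X \<in> class_B" using inf by (auto simp: class_B_def borel_images_def)
qed

theorem theorem3p7:
  shows "S1 B_Tau B_Gamma = class_T \<inter> class_B"
  using S1_subset_class_T S1_subset_class_B class_T_class_B_subset_S1 by blast

end
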